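(* Let $T>0$ and let $(x_{\ell,\circ},x_\circ,v_{\ell,\circ},v_\circ)\in\mathcal S$ be an initial condition. Then the system $$\dot x_\ell=v_\ell,\quad \dot v_\ell=\mathsf a_\ell,\quad \dot x=v,\quad \dot v=\mathcal A(x_\ell,x,v_\ell,v;u),\quad (x_\ell(0),x(0),v_\ell(0),v(0))=(x_{\ell,\circ},x_\circ,v_{\ell,\circ},v_\circ)$$ has a solution $(x_\ell,x,v_\ell,v)\in W^{1,\infty}((0,T);\mathcal S)$ on $[0,T]$ (in the integral sense defined in the context). In addition, with $h_\circ=x_{\ell,\circ}-x_\circ$, there is a constant $H=H(T)>0$ such that $$\inf_{t\in[0,T]}\bigl(x_\ell(t)-x(t)\bigr)\;\ge\;\frac{k_v}{v_\circ+Hk_d+\frac{k_v}{h_\circ}}>0 .$$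
   Context: Fixed data: constants $k_v,k_d,k,\tau_s>0$; constants $0<\underline u<\bar u<\bar v<\infty$; a time horizon $T>0$; a control $u\in C([0,T];[\underline u,\bar u])$; a leader acceleration $\mathsf a_\ell\in C([0,T];\mathbb R)\cap L^\infty([0,T];\mathbb R)$ such that $0\le v_{\ell,\circ}+\int_0^t\mathsf a_\ell(s)\,ds\le\bar v$ for all $t\in[0,T]$. The acceleration of the following vehicle is $$\mathcal A(x_\ell,x,v_\ell,v;u)=\min\Bigl\{k_v\frac{v_\ell-v}{(x_\ell-x)^2}+k_d(x_\ell-x-\tau_s v),\;k(u-v)\Bigr\},$$ where $u=u(t)$ is evaluated at the current time. The state space is $\mathcal S=\{(x_1,x_2,v_1,v_2)\in\mathbb R^2\times\mathbb R_+^2:\ x_1-x_2>0,\ v_1,v_2\in[0,\bar v]\}$, with $\mathbb R_+=[0,\infty)$. Solution: a function $(x_\ell,x,v_\ell,v)\in W^{1,\infty}((0,T);\mathcal S)$ (identified with its continuous representative on $[0,T]$, taking values in $\mathcal S$) which satisfies the system in integral form for $t\in[0,T]$, i.e. $x_\ell(t)=x_{\ell,\circ}+\int_0^t v_\ell\,ds$, $v_\ell(t)=v_{\ell,\circ}+\int_0^t\mathsf a_\ell\,ds$, $x(t)=x_\circ+\int_0^t v\,ds$, $v(t)=v_\circ+\int_0^t\mathcal A(x_\ell,x,v_\ell,v;u)\,ds$. *)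

theory Defs
  imports "HOL-Analysis.Analysis"
begin

definition accel :: "real \<Rightarrow> real \<Rightarrow> real \<Rightarrow> real \<Rightarrow> real \<Rightarrow> real \<Rightarrow> real \<Rightarrow> real \<Rightarrow> real \<Rightarrow> real" where
  "accel k_v k_d k \<tau>\<^sub>s xl x vl v u =
     min (k_v * ((vl - v) / (xl - x)\<^sup>2) + k_d * (xl - x - \<tau>\<^sub>s * v)) (k * (u - v))"

definition state_space :: "real \<Rightarrow> (real \<times> real \<times> real \<times> real) set" where
  "state_space v_max =
     {(x1, x2, v1, v2). x1 - x2 > 0 \<and> v1 \<in> {0..v_max} \<and> v2 \<in> {0..v_max}}"

definition L_infinity :: "real set \<Rightarrow> (real \<Rightarrow> 'a::euclidean_space) set" where
  "L_infinity I = {f. f \<in> borel_measurable (lebesgue_on I) \<and>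
     (\<exists>C. AE t in lebesgue_on I. norm (f t) \<le> C)}"

definition test_functions :: "real set \<Rightarrow> (real \<Rightarrow> real) set" where
  "test_functions I = {\<phi>. (\<forall>n t. (deriv ^^ n) \<phi> field_differentiable at t) \<and>
     compact (closure {t. \<phi> t \<noteq> 0}) \<and> closure {t. \<phi> t \<noteq> 0} \<subseteq> I}"

definition weak_derivative :: "real set \<Rightarrow> (real \<Rightarrow> 'a::euclidean_space) \<Rightarrow> (real \<Rightarrow> 'a) \<Rightarrow> bool" where
  "weak_derivative I f g \<longleftrightarrow> (\<forall>\<phi>\<in>test_functions I.
     (\<integral>t. deriv \<phi> t *\<^sub>R f t \<partial>lebesgue_on I) = - (\<integral>t. \<phi> t *\<^sub>R g t \<partial>lebesgue_on I))"

definition W1_infinity :: "real set \<Rightarrow> (real \<Rightarrow> 'a::euclidean_space) set" where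
  "W1_infinity I = {f \<in> L_infinity I. \<exists>g\<in>L_infinity I. weak_derivative I f g}"

text \<open>
  A class in \<open>W\<^sup>1\<^sup>,\<^sup>\<infinity>\<close> on the open interval is given by its continuous representative on the
  closed one; this is the curve that has to take its values in the state space. The
  integral equations are stated with \<open>has_integral\<close>, so that integrability is part of them.
\<close>
definition is_solution ::
  "real \<Rightarrow> real \<Rightarrow> real \<Rightarrow> real \<Rightarrow> real \<Rightarrow> real \<Rightarrow> (real \<Rightarrow> real) \<Rightarrow> (real \<Rightarrow> real) \<Rightarrow>
   real \<times> real \<times> real \<times> real \<Rightarrow> (real \<Rightarrow> real \<times> real \<times> real \<times> real) \<Rightarrow> bool" where
  "is_solution k_v k_d k \<tau>\<^sub>s v_max T u a = (\<lambda>(xl0, x0, vl0, v0) z.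
     z \<in> W1_infinity {0<..<T} \<and>
     continuous_on {0..T} z \<and>
     (\<forall>t\<in>{0..T}. z t \<in> state_space v_max) \<and>
     (\<exists>xl x vl v. z = (\<lambda>t. (xl t, x t, vl t, v t)) \<and>
       (\<forall>t\<in>{0..T}.
         (vl has_integral (xl t - xl0)) {0..t} \<and>
         (a has_integral (vl t - vl0)) {0..t} \<and>
         (v has_integral (x t - x0)) {0..t} \<and>
         ((\<lambda>s. accel k_v k_d k \<tau>\<^sub>s (xl s) (x s) (vl s) (v s) (u s))
            has_integral (v t - v0)) {0..t})))"

end

theory Submission imports Defs begin

text \<open>
  The leader does not depend on the follower: its velocity and position are iterated primitives
  of \<open>a\<close>. What remains is an ordinary differential equation for the follower alone, whose right
  hand side is Lipschitz as long as the headway \<open>h = xl - x\<close> stays away from \<open>0\<close> and the velocity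
  \<open>v\<close> stays bounded. It is therefore replaced by a globally Lipschitz one, in which \<open>h\<close> is cut off
  below at some \<open>\<delta> > 0\<close> and \<open>v\<close> is clamped to \<open>[0, V]\<close>, with \<open>V\<close> the maximal speed
  (\<open>truncated_accel_lipschitz\<close>). The truncated system has a global solution by the
  Picard--Lindeloef theorem (\<open>picard_lindelof_global\<close>), and the task is to see that the truncation
  is never active.

  For the velocity this is a barrier argument (\<open>nonneg_barrier\<close>): below \<open>0\<close> the truncated
  acceleration is nonnegative, and above \<open>V\<close> the relaxation term \<open>k (u - v)\<close> makes it nonpositive.

  For the headway, the point is that the interaction term is an exact derivative,
  \<open>k_v (vl - v) / h\<^sup>2 = - (k_v / h)'\<close>. Since the minimum in the acceleration is at most its first
  argument, \<open>v + k_v / h\<close> grows at a rate of at most \<open>k_d h\<close>, which is bounded on \<open>[0, T]\<close>; this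
  bounds \<open>k_v / h\<close> from above, hence \<open>h\<close> from below by the number \<open>B\<close> of the theorem
  (\<open>headway_lower_bound\<close>). The bound is valid up to a time \<open>S\<close> if \<open>h \<ge> \<delta>\<close> holds up to \<open>S\<close>.
  With \<open>\<delta> = B / 2\<close> the headway can then never reach \<open>\<delta>\<close>, since at the first time it did, it would
  also be at least \<open>B\<close> (\<open>follower_solution\<close>).

  The constant \<open>H\<close> has to serve all initial headways at once, whereas the bound on \<open>h\<close> used above
  grows with \<open>h 0\<close>. But \<open>h\<close> changes by at most \<open>V T\<close>. If \<open>h 0 < V T + 1\<close>, then
  \<open>h \<le> 2 V T + 1\<close>, so \<open>H \<ge> T (2 V T + 1)\<close> is enough; if \<open>h 0 \<ge> V T + 1\<close>, then \<open>h \<ge> 1\<close>, and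
  \<open>H \<ge> k_v / k_d\<close> makes \<open>B \<le> 1\<close>.

  As the data are continuous, the solution is continuously differentiable up to the boundary, so
  its classical derivative is also its weak one (\<open>C1_imp_W1_infinity\<close>).
\<close>

section \<open>Sobolev regularity of continuously differentiable curves\<close>

lemma continuous_on_imp_L_infinity:
  fixes f :: "real \<Rightarrow> 'a::euclidean_space"
  assumes "continuous_on {a..b} f"
  shows "f \<in> L_infinity {a<..<b}"
proof -
  have "continuous_on {a<..<b} f"
    using assms by (rule continuous_on_subset) auto
  then have "f \<in> borel_measurable (lebesgue_on {a<..<b})"
    by (rule continuous_imp_measurable_on_sets_lebesgue) auto
  moreover have "bounded (f ` {a..b})"
    using assms by (intro compact_imp_bounded compact_continuous_image) auto
  then obtain C where "\<And>t. t \<in> {a..b} \<Longrightarrow> norm (f t) \<le> C"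
    unfolding bounded_iff by blast
  then have "AE t in lebesgue_on {a<..<b}. norm (f t) \<le> C"
    by (intro AE_I2) (auto simp: space_restrict_space)
  ultimately show ?thesis
    unfolding L_infinity_def by blast
qed

lemma continuous_on_integrable_lebesgue_on_Ioo:
  fixes f :: "real \<Rightarrow> 'a::euclidean_space"
  assumes "continuous_on {a..b} f"
  shows "integrable (lebesgue_on {a<..<b}) f"
proof -
  have "f absolutely_integrable_on {a..b}"
    by (rule absolutely_integrable_continuous_real[OF assms])
  then have "f absolutely_integrable_on {a<..<b}"
    by (rule set_integrable_subset) auto
  then show ?thesis
    by (simp add: integrable_restrict_space set_integrable_def)
qed

lemma test_function_vanishes_outside:
  assumes "\<phi> \<in> test_functions I" "t \<notin> I"
  shows "\<phi> t = 0"
  using assms closure_subset[of "{t. \<phi> t \<noteq> 0}"] by (auto simp: test_functions_def)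

text \<open>
  Integration by parts: the boundary terms vanish because the support of a test function is
  contained in the open interval.
\<close>
lemma C1_imp_weak_derivative:
  fixes f g :: "real \<Rightarrow> 'a::euclidean_space"
  assumes "a \<le> b"
    and deriv: "\<And>t. t \<in> {a..b} \<Longrightarrow> (f has_vector_derivative g t) (at t within {a..b})"
    and contg: "continuous_on {a..b} g"
  shows "weak_derivative {a<..<b} f g"
  unfolding weak_derivative_def
proof
  fix \<phi> assume \<phi>: "\<phi> \<in> test_functions {a<..<b}"
  let ?M = "lebesgue_on {a<..<b}"
  have smooth: "(deriv ^^ n) \<phi> field_differentiable at t" for n t
    using \<phi> by (auto simp: test_functions_def)
  have d\<phi>: "(\<phi> has_real_derivative deriv \<phi> t) (at t)" for t
    using smooth[of 0 t] by (simp add: DERIV_deriv_iff_field_differentiable)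
  have cont\<phi>: "continuous_on {a..b} \<phi>"
    using d\<phi> by (meson DERIV_isCont continuous_at_imp_continuous_on)
  have contd: "continuous_on {a..b} (deriv \<phi>)"
    using smooth[of 1] by (auto intro!: continuous_at_imp_continuous_on
        field_differentiable_imp_continuous_at)
  have contf: "continuous_on {a..b} f"
    by (rule continuous_on_vector_derivative[OF deriv])
  have int1: "integrable ?M (\<lambda>t. deriv \<phi> t *\<^sub>R f t)"
    by (intro continuous_on_integrable_lebesgue_on_Ioo continuous_intros contf contd)
  have int2: "integrable ?M (\<lambda>t. \<phi> t *\<^sub>R g t)"
    by (intro continuous_on_integrable_lebesgue_on_Ioo continuous_intros contg cont\<phi>)
  have "((\<lambda>t. \<phi> t *\<^sub>R g t + deriv \<phi> t *\<^sub>R f t) has_integral \<phi> b *\<^sub>R f b - \<phi> a *\<^sub>R f a) {a..b}"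
    using \<open>a \<le> b\<close> deriv d\<phi>
    by (intro fundamental_theorem_of_calculus has_vector_derivative_scaleR)
       (auto intro: has_field_derivative_at_within)
  then have "((\<lambda>t. \<phi> t *\<^sub>R g t + deriv \<phi> t *\<^sub>R f t) has_integral 0) {a<..<b}"
    using test_function_vanishes_outside[OF \<phi>, of a] test_function_vanishes_outside[OF \<phi>, of b]
    by (simp add: has_integral_Icc_iff_Ioo)
  moreover have "integral\<^sup>L ?M (\<lambda>t. \<phi> t *\<^sub>R g t + deriv \<phi> t *\<^sub>R f t)
      = integral {a<..<b} (\<lambda>t. \<phi> t *\<^sub>R g t + deriv \<phi> t *\<^sub>R f t)"
    by (intro lebesgue_integral_eq_integral Bochner_Integration.integrable_add int1 int2) auto
  ultimately have "integral\<^sup>L ?M (\<lambda>t. \<phi> t *\<^sub>R g t + deriv \<phi> t *\<^sub>R f t) = 0"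
    by (simp add: integral_unique)
  then show "(\<integral>t. deriv \<phi> t *\<^sub>R f t \<partial>?M) = - (\<integral>t. \<phi> t *\<^sub>R g t \<partial>?M)"
    using int1 int2 by (simp add: eq_neg_iff_add_eq_0 add.commute)
qed

lemma C1_imp_W1_infinity:
  fixes f g :: "real \<Rightarrow> 'a::euclidean_space"
  assumes "a \<le> b"
    and "\<And>t. t \<in> {a..b} \<Longrightarrow> (f has_vector_derivative g t) (at t within {a..b})"
    and "continuous_on {a..b} g"
  shows "f \<in> W1_infinity {a<..<b}"
proof -
  have "continuous_on {a..b} f"
    by (rule continuous_on_vector_derivative[OF assms(2)])
  then show ?thesis
    unfolding W1_infinity_def
    using assms C1_imp_weak_derivative continuous_on_imp_L_infinity by blast
qed

section \<open>Global solutions of Lipschitz differential equations\<close>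

lemma integral_exp_scaled:
  fixes L t :: real
  assumes "L > 0" "t \<ge> 0"
  shows "((\<lambda>s. exp (L * s)) has_integral (exp (L * t) - 1) / L) {0..t}"
proof -
  have "((\<lambda>s. exp (L * s)) has_integral exp (L * t) / L - exp (L * 0) / L) {0..t}"
    using assms by (intro fundamental_theorem_of_calculus)
      (auto intro!: derivative_eq_intros simp flip: has_real_derivative_iff_has_vector_derivative)
  then show ?thesis by (simp add: diff_divide_distrib)
qed

text \<open>
  The Picard operator is a contraction on the whole interval at once, of whatever length, for the
  norm \<open>sup exp (- L t) |z t|\<close> with \<open>L\<close> large compared with \<open>K\<close>. To stay within the complete
  metric space of bounded continuous functions on the real line with its usual distance, the
  operator \<open>J\<close> acts on the rescaled function \<open>w t = exp (- L t) z t\<close>, and its values are extended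
  constantly outside \<open>[0, T]\<close> by means of the projection \<open>p\<close>.
\<close>
lemma picard_lindelof_global:
  fixes f :: "real \<Rightarrow> 'a::banach \<Rightarrow> 'a"
  assumes "T \<ge> 0"
    and cont: "continuous_on ({0..T} \<times> UNIV) (\<lambda>(t, x). f t x)"
    and lip: "\<And>t x y. t \<in> {0..T} \<Longrightarrow> norm (f t x - f t y) \<le> K * norm (x - y)"
  obtains z where "z 0 = z0"
    "\<And>t. t \<in> {0..T} \<Longrightarrow> (z has_vector_derivative f t (z t)) (at t within {0..T})"
proof -
  \<comment> \<open>\<open>J\<close> has Lipschitz constant \<open>\<bar>K\<bar> / L\<close>, so this choice gives \<open>1/2\<close>.\<close>
  define L where "L = 2 * \<bar>K\<bar> + 1"
  have "L > 0" by (simp add: L_def add_nonneg_pos)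
  define p where "p t = max 0 (min T t)" for t
  have p_mem: "p t \<in> {0..T}" for t using \<open>T \<ge> 0\<close> by (auto simp: p_def)
  have p_id: "p t = t" if "t \<in> {0..T}" for t using that by (auto simp: p_def)
  have contp: "continuous_on UNIV p" unfolding p_def by (intro continuous_intros)
  define F where "F w s = f s (exp (L * s) *\<^sub>R apply_bcontfun w s)" for w s
  define J where "J w t = exp (- (L * t)) *\<^sub>R (z0 + integral {0..t} (F w))" for w t
  have contF: "continuous_on {0..T} (F w)" for w
  proof -
    have "continuous_on {0..T} (\<lambda>s. (\<lambda>(t, x). f t x) (s, exp (L * s) *\<^sub>R apply_bcontfun w s))"
      by (rule continuous_on_compose2[OF cont]) (auto intro!: continuous_intros)
    then show ?thesis by (simp add: F_def[abs_def])
  qed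
  have intF: "F w integrable_on {0..t}" if "t \<in> {0..T}" for w t
    using that by (intro integrable_continuous_real continuous_on_subset[OF contF]) auto
  have contJ: "continuous_on {0..T} (J w)" for w
    unfolding J_def[abs_def]
    by (intro continuous_intros indefinite_integral_continuous_1 intF) (use \<open>T \<ge> 0\<close> in auto)
  have J_bcontfun: "(\<lambda>t. J w (p t)) \<in> bcontfun" for w
  proof -
    have "continuous_on UNIV (\<lambda>t. J w (p t))"
      by (rule continuous_on_compose2[OF contJ contp]) (use p_mem in auto)
    moreover have "bounded (J w ` {0..T})"
      by (intro compact_imp_bounded compact_continuous_image contJ) auto
    then have "bounded (range (\<lambda>t. J w (p t)))"
      by (rule bounded_subset) (use p_mem in auto)
    ultimately show ?thesis by (simp add: bcontfun_def)
  qed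
  define \<Phi> where "\<Phi> w = Bcontfun (\<lambda>t. J w (p t))" for w
  have \<Phi>_apply: "apply_bcontfun (\<Phi> w) t = J w (p t)" for w t
    by (simp add: \<Phi>_def Bcontfun_inverse[OF J_bcontfun])
  have J_contracts: "norm (J w1 t - J w2 t) \<le> 1/2 * dist w1 w2" if t: "t \<in> {0..T}" for w1 w2 t
  proof -
    have "norm (integral {0..t} (\<lambda>s. F w1 s - F w2 s))
        \<le> integral {0..t} (\<lambda>s. \<bar>K\<bar> * dist w1 w2 * exp (L * s))"
    proof (rule integral_norm_bound_integral)
      show "(\<lambda>s. F w1 s - F w2 s) integrable_on {0..t}"
        by (intro integrable_diff intF t)
      show "(\<lambda>s. \<bar>K\<bar> * dist w1 w2 * exp (L * s)) integrable_on {0..t}"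
        by (intro integrable_continuous_real continuous_intros)
      fix s assume s: "s \<in> {0..t}"
      have "norm (F w1 s - F w2 s)
          \<le> K * norm (exp (L * s) *\<^sub>R apply_bcontfun w1 s - exp (L * s) *\<^sub>R apply_bcontfun w2 s)"
        unfolding F_def using s t by (intro lip) auto
      also have "\<dots> = K * (exp (L * s) * dist (apply_bcontfun w1 s) (apply_bcontfun w2 s))"
        by (simp add: dist_norm flip: scaleR_diff_right)
      also have "\<dots> \<le> \<bar>K\<bar> * (exp (L * s) * dist w1 w2)"
        by (intro mult_mono mult_left_mono dist_bounded) auto
      finally show "norm (F w1 s - F w2 s) \<le> \<bar>K\<bar> * dist w1 w2 * exp (L * s)"
        by (simp add: mult_ac)
    qed
    also have "\<dots> = \<bar>K\<bar> * dist w1 w2 * ((exp (L * t) - 1) / L)"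
      using integral_exp_scaled[OF \<open>L > 0\<close>, of t] t by (simp add: integral_unique)
    finally have *: "norm (integral {0..t} (F w1) - integral {0..t} (F w2))
        \<le> \<bar>K\<bar> * dist w1 w2 * ((exp (L * t) - 1) / L)"
      by (simp only: Henstock_Kurzweil_Integration.integral_diff[OF intF[OF t] intF[OF t]])
    have "J w1 t - J w2 t = exp (- (L * t)) *\<^sub>R (integral {0..t} (F w1) - integral {0..t} (F w2))"
      by (simp add: J_def flip: scaleR_diff_right)
    then have "norm (J w1 t - J w2 t)
        = exp (- (L * t)) * norm (integral {0..t} (F w1) - integral {0..t} (F w2))"
      by simp
    also have "\<dots> \<le> exp (- (L * t)) * (\<bar>K\<bar> * dist w1 w2 * ((exp (L * t) - 1) / L))"
      by (intro mult_left_mono *) auto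
    also have "\<dots> = (\<bar>K\<bar> / L) * dist w1 w2 * (exp (- (L * t)) * (exp (L * t) - 1))"
      by simp
    also have "\<dots> \<le> 1/2 * dist w1 w2 * 1"
    proof (intro mult_mono)
      show "\<bar>K\<bar> / L \<le> 1/2" using \<open>L > 0\<close> by (simp add: L_def field_simps)
      show "exp (- (L * t)) * (exp (L * t) - 1) \<le> 1"
        by (simp add: algebra_simps flip: exp_add)
      show "0 \<le> exp (- (L * t)) * (exp (L * t) - 1)"
        using t \<open>L > 0\<close> by simp
    qed auto
    finally show ?thesis by simp
  qed
  have "dist (\<Phi> w1) (\<Phi> w2) \<le> 1/2 * dist w1 w2" for w1 w2
  proof (rule dist_bound)
    show "dist (apply_bcontfun (\<Phi> w1) t) (apply_bcontfun (\<Phi> w2) t) \<le> 1/2 * dist w1 w2" for t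
      unfolding \<Phi>_apply dist_norm[of "J w1 (p t)"] by (rule J_contracts[OF p_mem])
  qed
  then have "\<exists>!w. \<Phi> w = w"
    by (intro banach_fix_type[of "1/2"]) auto
  then obtain w where w: "\<Phi> w = w" by blast
  define z where "z t = z0 + integral {0..t} (F w)" for t
  have z_w: "exp (L * t) *\<^sub>R apply_bcontfun w t = z t" if "t \<in> {0..T}" for t
  proof -
    have "apply_bcontfun w t = J w t"
      using \<Phi>_apply[of w t] by (simp only: w p_id[OF that])
    then show ?thesis by (simp add: J_def z_def flip: exp_add)
  qed
  show thesis
  proof
    show "z 0 = z0" by (simp add: z_def)
    fix t assume t: "t \<in> {0..T}"
    have "((\<lambda>t. z0 + integral {0..t} (F w)) has_vector_derivative 0 + F w t) (at t within {0..T})"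
      by (intro has_vector_derivative_add integral_has_vector_derivative contF t) auto
    then show "(z has_vector_derivative f t (z t)) (at t within {0..T})"
      by (simp add: z_def[abs_def, symmetric] F_def z_w[OF t])
  qed
qed

section \<open>Comparison arguments for one derivative\<close>

lemma DERIV_within_nonpos_imp_le:
  fixes f :: "real \<Rightarrow> real"
  assumes "a \<le> b"
    and "\<And>t. t \<in> {a..b} \<Longrightarrow> (f has_real_derivative d t) (at t within {a..b})"
    and "\<And>t. t \<in> {a<..<b} \<Longrightarrow> d t \<le> 0"
  shows "f b \<le> f a"
proof (cases "a = b")
  case False
  then have "a < b" using \<open>a \<le> b\<close> by simp
  then obtain t where "t \<in> {a<..<b}" "f b - f a = d t * (b - a)"
    using mvt_simple[of a b f "\<lambda>t. (*) (d t)"] assms(2)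
    by (auto simp: has_field_derivative_def)
  then show ?thesis
    using assms(3)[of t] \<open>a < b\<close> mult_nonpos_nonneg[of "d t" "b - a"] by simp
qed simp

text \<open>
  After the last time before \<open>t1\<close> at which \<open>f\<close> is nonnegative, \<open>f\<close> would be negative and hence
  nondecreasing, so it could not get below its value there.
\<close>
lemma nonneg_barrier:
  fixes f :: "real \<Rightarrow> real"
  assumes deriv: "\<And>t. t \<in> {0..T} \<Longrightarrow> (f has_real_derivative d t) (at t within {0..T})"
    and push: "\<And>t. t \<in> {0..T} \<Longrightarrow> f t < 0 \<Longrightarrow> 0 \<le> d t"
    and "0 \<le> f 0" and t1: "t1 \<in> {0..T}"
  shows "0 \<le> f t1"
proof (rule ccontr)
  assume "\<not> 0 \<le> f t1"
  have contf: "continuous_on {0..T} f"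
    by (rule DERIV_continuous_on[OF deriv])
  define C where "C = {0..t1} \<inter> f -` {0..}"
  have "continuous_on {0..t1} f"
    using contf by (rule continuous_on_subset) (use t1 in auto)
  then have "closed C"
    unfolding C_def by (rule continuous_closed_preimage) auto
  then have "compact C"
    using compact_Icc[of 0 t1] unfolding C_def
    by (metis Int_lower1 bounded_closed_interval bounded_subset compact_eq_bounded_closed)
  moreover have "C \<noteq> {}"
    using t1 \<open>0 \<le> f 0\<close> by (auto simp: C_def)
  ultimately obtain t0 where t0: "t0 \<in> C" "\<And>t. t \<in> C \<Longrightarrow> t \<le> t0"
    using compact_attains_sup by metis
  have "- f t1 \<le> - f t0"
  proof (rule DERIV_within_nonpos_imp_le[where f = "\<lambda>t. - f t" and d = "\<lambda>t. - d t"])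
    show "t0 \<le> t1" using t0(1) by (auto simp: C_def)
    fix t
    show "((\<lambda>t. - f t) has_real_derivative - d t) (at t within {t0..t1})" if "t \<in> {t0..t1}"
      using that t0(1) t1
      by (intro DERIV_minus DERIV_subset[OF deriv]) (auto simp: C_def)
    show "- d t \<le> 0" if "t \<in> {t0<..<t1}"
    proof -
      have "t \<notin> C" using t0(2)[of t] that by auto
      then have "f t < 0" using that t0(1) by (auto simp: C_def)
      then show ?thesis using push[of t] that t0(1) t1 by (auto simp: C_def)
    qed
  qed
  then show False
    using \<open>\<not> 0 \<le> f t1\<close> t0(1) by (auto simp: C_def)
qed

section \<open>The lower bound for the headway\<close>

text \<open>
  The energy \<open>v + k_v / h - k_d M t\<close> is nonincreasing for any upper bound \<open>M\<close> of \<open>h\<close>, because the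
  derivative of \<open>k_v / h\<close> cancels the singular term of the acceleration. The lemma holds on each
  initial interval \<open>[0, S]\<close>, with a bound that does not depend on \<open>S\<close>, so that it can be applied up to the
  first time at which a solution might be lost. The two conditions on \<open>H\<close> correspond to small and
  large initial headway.
\<close>
lemma headway_lower_bound:
  fixes h v w d :: "real \<Rightarrow> real"
  assumes "k_v > 0" "k_d > 0" "V \<ge> 0" "0 \<le> S" "S \<le> T"
    and H: "H \<ge> T * (2 * V * T + 1)" "H \<ge> k_v / k_d"
    and dh: "\<And>t. t \<in> {0..S} \<Longrightarrow> (h has_real_derivative w t - v t) (at t within {0..S})"
    and dv: "\<And>t. t \<in> {0..S} \<Longrightarrow> (v has_real_derivative d t) (at t within {0..S})"
    and d: "\<And>t. t \<in> {0..S} \<Longrightarrow> d t \<le> k_v * ((w t - v t) / (h t)\<^sup>2) + k_d * h t"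
    and pos: "\<And>t. t \<in> {0..S} \<Longrightarrow> 0 < h t"
    and w: "\<And>t. t \<in> {0..S} \<Longrightarrow> w t \<in> {0..V}"
    and v: "\<And>t. t \<in> {0..S} \<Longrightarrow> v t \<in> {0..V}"
  shows "k_v / (v 0 + H * k_d + k_v / h 0) \<le> h S"
proof -
  have "0 \<le> T" using assms by simp
  have upper: "h t \<le> h 0 + V * t" if "t \<in> {0..S}" for t
  proof -
    have "h t - V * t \<le> h 0 - V * 0"
    proof (rule DERIV_within_nonpos_imp_le[where f = "\<lambda>t. h t - V * t" and d = "\<lambda>t. w t - v t - V"])
      show "((\<lambda>t. h t - V * t) has_real_derivative w s - v s - V) (at s within {0..t})"
        if "s \<in> {0..t}" for s
        using that \<open>t \<in> {0..S}\<close>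
        by (auto intro!: derivative_eq_intros DERIV_subset[OF dh])
      show "w s - v s - V \<le> 0" if "s \<in> {0<..<t}" for s
        using that \<open>t \<in> {0..S}\<close> w[of s] v[of s] by simp
    qed (use that in auto)
    then show ?thesis by simp
  qed
  have lower: "h 0 - V * S \<le> h S"
  proof -
    have "- h S - V * S \<le> - h 0 - V * 0"
    proof (rule DERIV_within_nonpos_imp_le[where f = "\<lambda>t. - h t - V * t" and d = "\<lambda>t. - (w t - v t) - V"])
      show "((\<lambda>t. - h t - V * t) has_real_derivative - (w s - v s) - V) (at s within {0..S})"
        if "s \<in> {0..S}" for s
        using that by (auto intro!: derivative_eq_intros dh)
      show "- (w s - v s) - V \<le> 0" if "s \<in> {0<..<S}" for s
        using that w[of s] v[of s] by simp
    qed (use \<open>0 \<le> S\<close> in auto)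
    then show ?thesis by simp
  qed
  define D where "D = v 0 + H * k_d + k_v / h 0"
  have "k_v \<le> H * k_d"
    using H(2) \<open>k_d > 0\<close> by (simp add: field_simps)
  have "0 \<le> v 0" "0 < k_v / h 0" "0 < h S"
    using v[of 0] pos[of 0] pos[of S] \<open>k_v > 0\<close> \<open>0 \<le> S\<close> by auto
  then have "k_v \<le> D" "D > 0"
    using \<open>k_v \<le> H * k_d\<close> \<open>k_v > 0\<close> by (auto simp: D_def)
  have VS: "V * t \<le> V * T" if "t \<in> {0..S}" for t
    using that \<open>V \<ge> 0\<close> \<open>S \<le> T\<close> by (intro mult_left_mono) auto
  show ?thesis
  proof (cases "h 0 \<ge> V * T + 1")
    case True
    have "k_v / D \<le> 1" using \<open>k_v \<le> D\<close> \<open>D > 0\<close> by simp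
    also have "1 \<le> h S" using lower True VS[of S] \<open>0 \<le> S\<close> by simp
    finally show ?thesis by (simp add: D_def)
  next
    case False
    define M where "M = 2 * V * T + 1"
    have hM: "h t \<le> M" if "t \<in> {0..S}" for t
      using upper[OF that] VS[OF that] False by (simp add: M_def)
    have "v S + k_v / h S - k_d * M * S \<le> v 0 + k_v / h 0 - k_d * M * 0"
    proof (rule DERIV_within_nonpos_imp_le
        [where f = "\<lambda>t. v t + k_v / h t - k_d * M * t"
          and d = "\<lambda>t. d t - k_v * ((w t - v t) / (h t)\<^sup>2) - k_d * M"])
      fix t assume t: "t \<in> {0..S}"
      show "((\<lambda>t. v t + k_v / h t - k_d * M * t) has_real_derivative
          d t - k_v * ((w t - v t) / (h t)\<^sup>2) - k_d * M) (at t within {0..S})"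
        using pos[OF t]
        by (auto intro!: derivative_eq_intros dh[OF t] dv[OF t] simp: power2_eq_square)
    next
      fix t assume "t \<in> {0<..<S}"
      then have t: "t \<in> {0..S}" by auto
      have "k_d * h t \<le> k_d * M"
        using hM[OF t] \<open>k_d > 0\<close> by simp
      then show "d t - k_v * ((w t - v t) / (h t)\<^sup>2) - k_d * M \<le> 0"
        using d[OF t] by simp
    qed (rule \<open>0 \<le> S\<close>)
    moreover have "M * S \<le> H"
      using H(1) mult_left_mono[OF \<open>S \<le> T\<close>, of M] \<open>V \<ge> 0\<close> \<open>0 \<le> T\<close>
      by (simp add: M_def mult.commute)
    then have "k_d * M * S \<le> H * k_d"
      using \<open>k_d > 0\<close> by (simp add: mult.commute mult.left_commute)
    moreover have "0 \<le> v S" using v[of S] \<open>0 \<le> S\<close> by auto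
    ultimately have "k_v / h S \<le> D"
      by (simp add: D_def)
    then have "k_v / D \<le> h S"
      using \<open>0 < h S\<close> \<open>D > 0\<close> by (simp add: field_simps)
    then show ?thesis by (simp add: D_def)
  qed
qed

section \<open>The truncated acceleration\<close>

lemma min_diff_le: "\<bar>min a b - min c d\<bar> \<le> \<bar>a - c\<bar> + \<bar>b - d\<bar>" for a b c d :: real
  by linarith

lemma quotient_square_lipschitz:
  fixes m m' q q' \<delta> V :: real
  assumes "\<delta> > 0" "m \<ge> \<delta>" "m' \<ge> \<delta>" "\<bar>q'\<bar> \<le> V"
  shows "\<bar>q / m\<^sup>2 - q' / m'\<^sup>2\<bar> \<le> \<bar>q - q'\<bar> / \<delta>\<^sup>2 + 2 * V / \<delta> ^ 3 * \<bar>m - m'\<bar>"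
proof -
  have r: "0 < inverse m" "inverse m \<le> inverse \<delta>" "0 < inverse m'" "inverse m' \<le> inverse \<delta>"
    using assms by auto
  have "\<bar>inverse m - inverse m'\<bar> = \<bar>m - m'\<bar> * (inverse m * inverse m')"
    using assms by (subst inverse_diff_inverse) (auto simp: abs_mult)
  also have "\<dots> \<le> \<bar>m - m'\<bar> * (inverse \<delta> * inverse \<delta>)"
    using r \<open>\<delta> > 0\<close> by (intro mult_left_mono mult_mono) auto
  finally have 1: "\<bar>inverse m - inverse m'\<bar> \<le> \<bar>m - m'\<bar> * (inverse \<delta> * inverse \<delta>)" .
  have "\<bar>(inverse m)\<^sup>2 - (inverse m')\<^sup>2\<bar>
      = \<bar>inverse m - inverse m'\<bar> * (inverse m + inverse m')"
    using r by (simp add: power2_eq_square square_diff_square_factored abs_mult mult.commute)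
  also have "\<dots> \<le> (\<bar>m - m'\<bar> * (inverse \<delta> * inverse \<delta>)) * (2 * inverse \<delta>)"
  proof (intro mult_mono 1)
    show "inverse m + inverse m' \<le> 2 * inverse \<delta>" using r by linarith
  qed (use r \<open>\<delta> > 0\<close> in auto)
  finally have 2: "\<bar>(inverse m)\<^sup>2 - (inverse m')\<^sup>2\<bar>
      \<le> \<bar>m - m'\<bar> * (inverse \<delta> * inverse \<delta>) * (2 * inverse \<delta>)" .
  have "q / m\<^sup>2 - q' / m'\<^sup>2
      = (q - q') * (inverse m)\<^sup>2 + q' * ((inverse m)\<^sup>2 - (inverse m')\<^sup>2)"
    by (simp add: divide_inverse power_inverse algebra_simps)
  also have "\<bar>\<dots>\<bar> \<le> \<bar>q - q'\<bar> * (inverse m)\<^sup>2 + \<bar>q'\<bar> * \<bar>(inverse m)\<^sup>2 - (inverse m')\<^sup>2\<bar>"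
    by (rule order_trans[OF abs_triangle_ineq]) (simp add: abs_mult)
  also have "\<dots> \<le> \<bar>q - q'\<bar> * (inverse \<delta>)\<^sup>2
      + V * (\<bar>m - m'\<bar> * (inverse \<delta> * inverse \<delta>) * (2 * inverse \<delta>))"
    using r assms 2 by (intro add_mono mult_mono mult_left_mono power_mono) auto
  also have "\<dots> = \<bar>q - q'\<bar> / \<delta>\<^sup>2 + 2 * V / \<delta> ^ 3 * \<bar>m - m'\<bar>"
    by (simp add: divide_inverse power_inverse power2_eq_square power3_eq_cube mult_ac)
  finally show ?thesis .
qed

text \<open>
  Since the acceleration depends on the positions only through their difference, the truncated
  headway is passed as the position of the leader, with the follower at \<open>0\<close>.
\<close>
lemma truncated_accel_lipschitz:
  fixes k_v k_d k \<tau>\<^sub>s \<delta> V w u p :: real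
  assumes "k_v > 0" "k_d > 0" "k > 0" "\<tau>\<^sub>s > 0" "\<delta> > 0" "w \<in> {0..V}"
  defines "g \<equiv> \<lambda>x v. accel k_v k_d k \<tau>\<^sub>s (max \<delta> (p - x)) 0 w (max 0 (min V v)) u"
  shows "\<bar>g x v - g x' v'\<bar>
    \<le> (k_v * (1 / \<delta>\<^sup>2 + 2 * V / \<delta> ^ 3) + k_d * (1 + \<tau>\<^sub>s) + k) * (\<bar>x - x'\<bar> + \<bar>v - v'\<bar>)"
proof -
  define m m' c c' where "m = max \<delta> (p - x)" and "m' = max \<delta> (p - x')"
    and "c = max 0 (min V v)" and "c' = max 0 (min V v')"
  define e where "e = \<bar>x - x'\<bar> + \<bar>v - v'\<bar>"
  have "0 \<le> V" using assms by auto
  have m: "m \<ge> \<delta>" "m' \<ge> \<delta>" "\<bar>m - m'\<bar> \<le> e"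
    unfolding m_def m'_def e_def by linarith+
  have c: "\<bar>c - c'\<bar> \<le> e" "\<bar>w - c'\<bar> \<le> V"
    using \<open>w \<in> {0..V}\<close> \<open>0 \<le> V\<close> unfolding c_def c'_def e_def atLeastAtMost_iff by linarith+
  have "\<bar>(w - c) / m\<^sup>2 - (w - c') / m'\<^sup>2\<bar>
      \<le> \<bar>(w - c) - (w - c')\<bar> / \<delta>\<^sup>2 + 2 * V / \<delta> ^ 3 * \<bar>m - m'\<bar>"
    by (rule quotient_square_lipschitz[OF \<open>\<delta> > 0\<close> m(1,2) c(2)])
  also have "\<dots> \<le> e / \<delta>\<^sup>2 + 2 * V / \<delta> ^ 3 * e"
    using c m \<open>0 \<le> V\<close> \<open>\<delta> > 0\<close> by (intro add_mono divide_right_mono mult_left_mono) auto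
  finally have "k_v * \<bar>(w - c) / m\<^sup>2 - (w - c') / m'\<^sup>2\<bar> \<le> k_v * (e / \<delta>\<^sup>2 + 2 * V / \<delta> ^ 3 * e)"
    using \<open>k_v > 0\<close> by (intro mult_left_mono) auto
  then have 1: "\<bar>k_v * ((w - c) / m\<^sup>2) - k_v * ((w - c') / m'\<^sup>2)\<bar>
      \<le> k_v * (1 / \<delta>\<^sup>2 + 2 * V / \<delta> ^ 3) * e"
    unfolding right_diff_distrib[symmetric] abs_mult
    using \<open>k_v > 0\<close> by (simp add: distrib_left distrib_right mult_ac)
  have "\<bar>(m - \<tau>\<^sub>s * c) - (m' - \<tau>\<^sub>s * c')\<bar> \<le> \<bar>m - m'\<bar> + \<bar>\<tau>\<^sub>s * (c - c')\<bar>"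
    by (simp add: algebra_simps)
  also have "\<dots> \<le> e + \<tau>\<^sub>s * e"
    using m c \<open>\<tau>\<^sub>s > 0\<close> by (simp add: abs_mult add_mono)
  finally have "k_d * \<bar>(m - \<tau>\<^sub>s * c) - (m' - \<tau>\<^sub>s * c')\<bar> \<le> k_d * (e + \<tau>\<^sub>s * e)"
    using \<open>k_d > 0\<close> by (intro mult_left_mono) auto
  then have 2: "\<bar>k_d * (m - \<tau>\<^sub>s * c) - k_d * (m' - \<tau>\<^sub>s * c')\<bar> \<le> k_d * (1 + \<tau>\<^sub>s) * e"
    using \<open>k_d > 0\<close>
    by (simp add: abs_mult distrib_left distrib_right mult.assoc flip: right_diff_distrib)
  have "\<bar>k * (u - c) - k * (u - c')\<bar> = k * \<bar>c - c'\<bar>"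
    using \<open>k > 0\<close> by (simp add: abs_mult abs_minus_commute flip: right_diff_distrib)
  then have 3: "\<bar>k * (u - c) - k * (u - c')\<bar> \<le> k * e"
    using c \<open>k > 0\<close> by simp
  have "\<bar>g x v - g x' v'\<bar>
      \<le> \<bar>(k_v * ((w - c) / m\<^sup>2) + k_d * (m - \<tau>\<^sub>s * c)) -
          (k_v * ((w - c') / m'\<^sup>2) + k_d * (m' - \<tau>\<^sub>s * c'))\<bar> + \<bar>k * (u - c) - k * (u - c')\<bar>"
    unfolding g_def accel_def m_def[symmetric] m'_def[symmetric] c_def[symmetric] c'_def[symmetric]
      diff_0_right
    by (rule min_diff_le)
  also have "\<dots> \<le> k_v * (1 / \<delta>\<^sup>2 + 2 * V / \<delta> ^ 3) * e + k_d * (1 + \<tau>\<^sub>s) * e + k * e"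
    using 1 2 3 by linarith
  finally show ?thesis
    by (simp add: e_def[symmetric] distrib_right)
qed

section \<open>Existence for a prescribed leader\<close>

lemma truncated_system_solution:
  fixes p w u :: "real \<Rightarrow> real" and k_v k_d k \<tau>\<^sub>s \<delta> V T x0 v0 :: real
  assumes "k_v > 0" "k_d > 0" "k > 0" "\<tau>\<^sub>s > 0" "\<delta> > 0" "T \<ge> 0"
    and contp: "continuous_on {0..T} p" and contw: "continuous_on {0..T} w"
    and contu: "continuous_on {0..T} u"
    and w: "\<And>t. t \<in> {0..T} \<Longrightarrow> w t \<in> {0..V}"
  obtains x v where "x 0 = x0" "v 0 = v0"
    "\<And>t. t \<in> {0..T} \<Longrightarrow> (x has_real_derivative v t) (at t within {0..T})"
    "\<And>t. t \<in> {0..T} \<Longrightarrow> (v has_real_derivative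
        accel k_v k_d k \<tau>\<^sub>s (max \<delta> (p t - x t)) 0 (w t) (max 0 (min V (v t))) (u t))
        (at t within {0..T})"
proof -
  define g where
    "g t x v = accel k_v k_d k \<tau>\<^sub>s (max \<delta> (p t - x)) 0 (w t) (max 0 (min V v)) (u t)" for t x v
  define f where "f t y = (snd y, g t (fst y) (snd y))" for t and y :: "real \<times> real"
  define C where "C = k_v * (1 / \<delta>\<^sup>2 + 2 * V / \<delta> ^ 3) + k_d * (1 + \<tau>\<^sub>s) + k"
  have "0 \<le> V" using w[of 0] \<open>T \<ge> 0\<close> by auto
  then have "C \<ge> 0"
    using assms by (simp add: C_def)
  have lip: "norm (f t y - f t y') \<le> (1 + 2 * C) * norm (y - y')" if "t \<in> {0..T}" for t y y'
  proof -
    have comp: "\<bar>fst y - fst y'\<bar> \<le> norm (y - y')" "\<bar>snd y - snd y'\<bar> \<le> norm (y - y')"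
      using norm_fst_le[of "fst y - fst y'" "snd y - snd y'"]
        norm_snd_le[of "snd y - snd y'" "fst y - fst y'"]
      by (simp_all add: minus_prod_def)
    have "\<bar>g t (fst y) (snd y) - g t (fst y') (snd y')\<bar>
        \<le> C * (\<bar>fst y - fst y'\<bar> + \<bar>snd y - snd y'\<bar>)"
      unfolding g_def C_def by (intro truncated_accel_lipschitz w assms that)
    also have "\<dots> \<le> C * (2 * norm (y - y'))"
      using comp \<open>C \<ge> 0\<close> by (intro mult_left_mono) auto
    finally have "norm (f t y - f t y') \<le> norm (y - y') + C * (2 * norm (y - y'))"
      using comp norm_Pair_le[of "snd y - snd y'" "g t (fst y) (snd y) - g t (fst y') (snd y')"]
      by (simp add: f_def)
    then show ?thesis by (simp add: algebra_simps)
  qed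
  have fst_cont: "continuous_on ({0..T} \<times> UNIV) (\<lambda>y. q (fst y))"
    if "continuous_on {0..T} q" for q :: "real \<Rightarrow> real"
    by (rule continuous_on_compose2[OF that]) (auto intro!: continuous_intros)
  have "continuous_on ({0..T} \<times> UNIV) (\<lambda>(t, y). f t y)"
    unfolding f_def g_def accel_def case_prod_beta
    by (intro continuous_intros fst_cont contp contw contu) (use \<open>\<delta> > 0\<close> in auto)
  then obtain z where z: "z 0 = (x0, v0)"
    "\<And>t. t \<in> {0..T} \<Longrightarrow> (z has_vector_derivative f t (z t)) (at t within {0..T})"
    using picard_lindelof_global[of T f "1 + 2 * C" "(x0, v0)"] \<open>T \<ge> 0\<close> lip by blast
  show thesis
  proof
    show "fst (z 0) = x0" "snd (z 0) = v0" using z(1) by auto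
    fix t assume t: "t \<in> {0..T}"
    show "((\<lambda>t. fst (z t)) has_real_derivative snd (z t)) (at t within {0..T})"
      using bounded_linear.has_vector_derivative[OF bounded_linear_fst z(2)[OF t]]
      by (simp add: f_def has_real_derivative_iff_has_vector_derivative)
    show "((\<lambda>t. snd (z t)) has_real_derivative
        accel k_v k_d k \<tau>\<^sub>s (max \<delta> (p t - fst (z t))) 0 (w t) (max 0 (min V (snd (z t)))) (u t))
        (at t within {0..T})"
      using bounded_linear.has_vector_derivative[OF bounded_linear_snd z(2)[OF t]]
      by (simp add: f_def g_def has_real_derivative_iff_has_vector_derivative)
  qed
qed

text \<open>
  The truncation level \<open>\<delta>\<close> is half the bound \<open>B\<close> to be shown: until \<open>h\<close> first meets \<open>\<delta>\<close> the
  truncated system is the true one, so \<open>h\<close> is at least \<open>B > \<delta>\<close> at that very time.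
\<close>
lemma follower_solution:
  fixes p w u :: "real \<Rightarrow> real" and k_v k_d k \<tau>\<^sub>s V T H x0 v0 :: real
  assumes "k_v > 0" "k_d > 0" "k > 0" "\<tau>\<^sub>s > 0" "T \<ge> 0"
    and H: "H \<ge> T * (2 * V * T + 1)" "H \<ge> k_v / k_d"
    and dp: "\<And>t. t \<in> {0..T} \<Longrightarrow> (p has_real_derivative w t) (at t within {0..T})"
    and contw: "continuous_on {0..T} w" and contu: "continuous_on {0..T} u"
    and w: "\<And>t. t \<in> {0..T} \<Longrightarrow> w t \<in> {0..V}"
    and u: "\<And>t. t \<in> {0..T} \<Longrightarrow> u t \<in> {0..V}"
    and "v0 \<in> {0..V}" "x0 < p 0"
  obtains x v where "x 0 = x0" "v 0 = v0"
    "\<And>t. t \<in> {0..T} \<Longrightarrow> (x has_real_derivative v t) (at t within {0..T})"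
    "\<And>t. t \<in> {0..T} \<Longrightarrow> (v has_real_derivative
        accel k_v k_d k \<tau>\<^sub>s (p t) (x t) (w t) (v t) (u t)) (at t within {0..T})"
    "\<And>t. t \<in> {0..T} \<Longrightarrow> v t \<in> {0..V}"
    "\<And>t. t \<in> {0..T} \<Longrightarrow> k_v / (v0 + H * k_d + k_v / (p 0 - x0)) \<le> p t - x t"
proof -
  define B where "B = k_v / (v0 + H * k_d + k_v / (p 0 - x0))"
  define \<delta> where "\<delta> = B / 2"
  have "0 < k_v / k_d" using \<open>k_v > 0\<close> \<open>k_d > 0\<close> by simp
  then have "0 < H" using H(2) by linarith
  then have D_pos: "0 < v0 + H * k_d + k_v / (p 0 - x0)"
    using assms by (intro add_pos_pos add_nonneg_pos mult_pos_pos divide_pos_pos) auto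
  then have "B > 0" using \<open>k_v > 0\<close> by (simp add: B_def)
  then have "\<delta> > 0" "\<delta> < B" by (auto simp: \<delta>_def)
  have "0 \<le> V" using \<open>v0 \<in> {0..V}\<close> by auto
  have contp: "continuous_on {0..T} p" by (rule DERIV_continuous_on[OF dp])
  obtain x v where xv0: "x 0 = x0" "v 0 = v0"
    and dx: "\<And>t. t \<in> {0..T} \<Longrightarrow> (x has_real_derivative v t) (at t within {0..T})"
    and dv': "\<And>t. t \<in> {0..T} \<Longrightarrow> (v has_real_derivative
        accel k_v k_d k \<tau>\<^sub>s (max \<delta> (p t - x t)) 0 (w t) (max 0 (min V (v t))) (u t))
        (at t within {0..T})"
    using truncated_system_solution[OF assms(1-4) \<open>\<delta> > 0\<close> \<open>T \<ge> 0\<close> contp contw contu w,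
        where ?x0.0 = x0 and ?v0.0 = v0] by blast
  define h where "h t = p t - x t" for t
  define d where
    "d t = accel k_v k_d k \<tau>\<^sub>s (max \<delta> (h t)) 0 (w t) (max 0 (min V (v t))) (u t)" for t
  have dv: "(v has_real_derivative d t) (at t within {0..T})" if "t \<in> {0..T}" for t
    using dv'[OF that] by (simp add: d_def h_def)
  have dh: "(h has_real_derivative w t - v t) (at t within {0..T})" if "t \<in> {0..T}" for t
    unfolding h_def[abs_def] using that by (intro DERIV_diff dp dx)
  have v_nonneg: "0 \<le> v t" if "t \<in> {0..T}" for t
  proof (rule nonneg_barrier[OF dv _ _ that])
    show "0 \<le> v 0" using xv0 \<open>v0 \<in> {0..V}\<close> by simp
    fix s assume s: "s \<in> {0..T}" "v s < 0"
    then have "max 0 (min V (v s)) = 0" by simp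
    then show "0 \<le> d s"
      using w[OF s(1)] u[OF s(1)] assms(1-4) \<open>\<delta> > 0\<close> by (simp add: d_def accel_def)
  qed
  have v_le: "0 \<le> V - v t" if "t \<in> {0..T}" for t
  proof (rule nonneg_barrier[where f = "\<lambda>t. V - v t" and d = "\<lambda>t. - d t", OF _ _ _ that])
    show "((\<lambda>t. V - v t) has_real_derivative - d s) (at s within {0..T})" if "s \<in> {0..T}" for s
      using DERIV_diff[OF DERIV_const dv[OF that]] by simp
    show "0 \<le> V - v 0" using xv0 \<open>v0 \<in> {0..V}\<close> by simp
    fix s assume s: "s \<in> {0..T}" "V - v s < 0"
    then have "max 0 (min V (v s)) = V" using \<open>0 \<le> V\<close> by simp
    then have "d s \<le> k * (u s - V)" by (simp add: d_def accel_def)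
    also have "\<dots> \<le> 0" using u[OF s(1)] \<open>k > 0\<close> by (simp add: mult_nonneg_nonpos)
    finally show "0 \<le> - d s" by simp
  qed
  have v: "v t \<in> {0..V}" if "t \<in> {0..T}" for t
    using v_nonneg[OF that] v_le[OF that] by simp
  have clamp_v: "max 0 (min V (v t)) = v t" if "t \<in> {0..T}" for t
    using v[OF that] by simp
  have d_bound: "d t \<le> k_v * ((w t - v t) / (h t)\<^sup>2) + k_d * h t"
    if "t \<in> {0..T}" "\<delta> \<le> h t" for t
  proof -
    have "k_d * (h t - \<tau>\<^sub>s * v t) \<le> k_d * h t"
      using v_nonneg[OF that(1)] \<open>k_d > 0\<close> \<open>\<tau>\<^sub>s > 0\<close> by (intro mult_left_mono) auto
    moreover have "d t \<le> k_v * ((w t - v t) / (h t)\<^sup>2) + k_d * (h t - \<tau>\<^sub>s * v t)"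
      unfolding d_def clamp_v[OF that(1)] max_absorb2[OF that(2)] accel_def diff_0_right
      by (rule min.cobounded1)
    ultimately show ?thesis by linarith
  qed
  have bound_upto: "B \<le> h S" if "S \<in> {0..T}" "\<And>t. t \<in> {0..S} \<Longrightarrow> \<delta> \<le> h t" for S
  proof -
    have "k_v / (v 0 + H * k_d + k_v / h 0) \<le> h S"
    proof (rule headway_lower_bound[OF \<open>k_v > 0\<close> \<open>k_d > 0\<close> \<open>0 \<le> V\<close> _ _ H])
      fix t assume t: "t \<in> {0..S}"
      then have t': "t \<in> {0..T}" using that(1) by auto
      show "(h has_real_derivative w t - v t) (at t within {0..S})"
        by (rule DERIV_subset[OF dh[OF t']]) (use that(1) in auto)
      show "(v has_real_derivative d t) (at t within {0..S})"
        by (rule DERIV_subset[OF dv[OF t']]) (use that(1) in auto)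
      show "d t \<le> k_v * ((w t - v t) / (h t)\<^sup>2) + k_d * h t"
        by (rule d_bound[OF t' that(2)[OF t]])
      show "0 < h t" using that(2)[OF t] \<open>\<delta> > 0\<close> by simp
      show "w t \<in> {0..V}" "v t \<in> {0..V}" by (rule w[OF t'] v[OF t'])+
    qed (use that(1) in auto)
    then show ?thesis by (simp add: B_def h_def xv0)
  qed
  have conth: "continuous_on {0..T} h" by (rule DERIV_continuous_on[OF dh])
  have h_ge: "\<delta> \<le> h t" if t: "t \<in> {0..T}" for t
  proof (rule ccontr)
    assume "\<not> \<delta> \<le> h t"
    define C where "C = {0..T} \<inter> h -` {..\<delta>}"
    have "compact C"
      unfolding C_def compact_eq_bounded_closed
      by (intro conjI bounded_Int continuous_closed_preimage conth) auto
    moreover have "t \<in> C" using t \<open>\<not> \<delta> \<le> h t\<close> by (simp add: C_def)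
    ultimately obtain S where S: "S \<in> C" "\<And>s. s \<in> C \<Longrightarrow> S \<le> s"
      using compact_attains_inf by (metis empty_iff)
    have before: "\<delta> < h s" if "s \<in> {0..<S}" for s
      using S(2)[of s] that S(1) by (auto simp: C_def not_le[symmetric])
    have "\<delta> \<le> h 0"
    proof -
      have "B \<le> k_v / (k_v / (p 0 - x0))"
        unfolding B_def
      proof (rule divide_left_mono)
        show "k_v / (p 0 - x0) \<le> v0 + H * k_d + k_v / (p 0 - x0)"
          using assms \<open>0 < H\<close> by simp
        show "0 < (v0 + H * k_d + k_v / (p 0 - x0)) * (k_v / (p 0 - x0))"
          using assms by (intro mult_pos_pos D_pos divide_pos_pos) auto
      qed (use \<open>k_v > 0\<close> in simp)
      then show ?thesis using \<open>\<delta> < B\<close> \<open>k_v > 0\<close> by (simp add: h_def xv0)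
    qed
    moreover have "h S \<le> \<delta>" using S(1) by (simp add: C_def)
    moreover have "continuous_on {0..S} h"
      using conth by (rule continuous_on_subset) (use S(1) in \<open>auto simp: C_def\<close>)
    ultimately obtain s where s: "0 \<le> s" "s \<le> S" "h s = \<delta>"
      using IVT2'[of h S \<delta> 0] S(1) by (auto simp: C_def)
    then have "h S = \<delta>" using before[of s] by (cases "s = S") auto
    have "B \<le> h S"
    proof (rule bound_upto)
      show "S \<in> {0..T}" using S(1) by (simp add: C_def)
      show "\<delta> \<le> h s" if "s \<in> {0..S}" for s
        using before[of s] that \<open>h S = \<delta>\<close> by (cases "s = S") auto
    qed
    then show False using \<open>h S = \<delta>\<close> \<open>\<delta> < B\<close> by simp
  qed
  show thesis
  proof (rule that[OF xv0 dx _ v])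
    fix t assume t: "t \<in> {0..T}"
    have "d t = accel k_v k_d k \<tau>\<^sub>s (p t) (x t) (w t) (v t) (u t)"
      unfolding d_def clamp_v[OF t] max_absorb2[OF h_ge[OF t]] by (simp add: accel_def h_def)
    then show "(v has_real_derivative accel k_v k_d k \<tau>\<^sub>s (p t) (x t) (w t) (v t) (u t))
        (at t within {0..T})"
      using dv[OF t] by simp
    show "k_v / (v0 + H * k_d + k_v / (p 0 - x0)) \<le> p t - x t"
      using bound_upto[OF t] h_ge t by (auto simp: B_def h_def)
  qed
qed

section \<open>Solvability of the leader-follower system\<close>

lemma C1_curve_is_solution:
  fixes xl x vl v a u :: "real \<Rightarrow> real"
  assumes "T \<ge> 0"
    and dxl: "\<And>t. t \<in> {0..T} \<Longrightarrow> (xl has_real_derivative vl t) (at t within {0..T})"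
    and dvl: "\<And>t. t \<in> {0..T} \<Longrightarrow> (vl has_real_derivative a t) (at t within {0..T})"
    and dx: "\<And>t. t \<in> {0..T} \<Longrightarrow> (x has_real_derivative v t) (at t within {0..T})"
    and dv: "\<And>t. t \<in> {0..T} \<Longrightarrow> (v has_real_derivative
        accel k_v k_d k \<tau>\<^sub>s (xl t) (x t) (vl t) (v t) (u t)) (at t within {0..T})"
    and conta: "continuous_on {0..T} a" and contu: "continuous_on {0..T} u"
    and mem: "\<And>t. t \<in> {0..T} \<Longrightarrow> (xl t, x t, vl t, v t) \<in> state_space V"
  shows "is_solution k_v k_d k \<tau>\<^sub>s V T u a (xl 0, x 0, vl 0, v 0) (\<lambda>t. (xl t, x t, vl t, v t))"
proof -
  let ?A = "\<lambda>t. accel k_v k_d k \<tau>\<^sub>s (xl t) (x t) (vl t) (v t) (u t)"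
  have cont: "continuous_on {0..T} xl" "continuous_on {0..T} x"
    "continuous_on {0..T} vl" "continuous_on {0..T} v"
    by (rule DERIV_continuous_on, erule dxl dx dvl dv)+
  have "xl t \<noteq> x t" if "t \<in> {0..T}" for t
    using mem[OF that] by (auto simp: state_space_def)
  then have contA: "continuous_on {0..T} ?A"
    unfolding accel_def by (intro continuous_intros cont contu) auto
  have W: "(\<lambda>t. (xl t, x t, vl t, v t)) \<in> W1_infinity {0<..<T}"
  proof (rule C1_imp_W1_infinity)
    show "((\<lambda>t. (xl t, x t, vl t, v t)) has_vector_derivative (vl t, v t, a t, ?A t))
        (at t within {0..T})" if "t \<in> {0..T}" for t
      using dxl[OF that] dx[OF that] dvl[OF that] dv[OF that]
      by (intro has_vector_derivative_Pair) (auto simp: has_real_derivative_iff_has_vector_derivative)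
    show "continuous_on {0..T} (\<lambda>t. (vl t, v t, a t, ?A t))"
      by (intro continuous_intros cont conta contA)
  qed (rule \<open>T \<ge> 0\<close>)
  have ftc: "(g has_integral q t - q 0) {0..t}"
    if "t \<in> {0..T}" "\<And>s. s \<in> {0..T} \<Longrightarrow> (q has_real_derivative g s) (at s within {0..T})"
    for g q :: "real \<Rightarrow> real" and t
  proof (rule fundamental_theorem_of_calculus)
    show "0 \<le> t" using that(1) by simp
    fix s assume "s \<in> {0..t}"
    then show "(q has_vector_derivative g s) (at s within {0..t})"
      using that(1) unfolding has_real_derivative_iff_has_vector_derivative[symmetric]
      by (intro DERIV_subset[OF that(2)]) auto
  qed
  have contz: "continuous_on {0..T} (\<lambda>t. (xl t, x t, vl t, v t))"
    by (intro continuous_intros cont)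
  show ?thesis
    unfolding is_solution_def prod.case
    by (intro conjI ballI W contz mem exI[of _ xl] exI[of _ x] exI[of _ vl] exI[of _ v] ftc
        dxl dx dvl dv refl)
qed

theorem mainTheorem1:
  fixes k_v k_d k \<tau>\<^sub>s u_min u_max v_max T :: real
  assumes "k_v > 0" and "k_d > 0" and "k > 0" and "\<tau>\<^sub>s > 0"
    and "0 < u_min" and "u_min < u_max" and "u_max < v_max"
    and "T > 0"
  shows "\<exists>H>0. \<forall>(u :: real \<Rightarrow> real) (a :: real \<Rightarrow> real) xl0 x0 vl0 v0.
    continuous_on {0..T} u \<longrightarrow> u ` {0..T} \<subseteq> {u_min..u_max} \<longrightarrow>
    continuous_on {0..T} a \<longrightarrow> a \<in> L_infinity {0..T} \<longrightarrow>
    (\<forall>t\<in>{0..T}. 0 \<le> vl0 + integral {0..t} a \<and> vl0 + integral {0..t} a \<le> v_max) \<longrightarrow>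
    (xl0, x0, vl0, v0) \<in> state_space v_max \<longrightarrow>
    (\<exists>xl x vl v.
      is_solution k_v k_d k \<tau>\<^sub>s v_max T u a (xl0, x0, vl0, v0) (\<lambda>t. (xl t, x t, vl t, v t)) \<and>
      (INF t\<in>{0..T}. xl t - x t) \<ge> k_v / (v0 + H * k_d + k_v / (xl0 - x0)) \<and>
      k_v / (v0 + H * k_d + k_v / (xl0 - x0)) > 0)"
proof -
  define H where "H = T * (2 * v_max * T + 1) + k_v / k_d"
  have H: "H \<ge> T * (2 * v_max * T + 1)" "H \<ge> k_v / k_d" "H > 0"
    using assms by (auto simp: H_def intro!: add_nonneg_pos)
  show ?thesis
  proof (intro exI[of _ H] conjI allI impI \<open>H > 0\<close>)
    fix u a :: "real \<Rightarrow> real" and xl0 x0 vl0 v0 :: real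
    assume contu: "continuous_on {0..T} u" and u: "u ` {0..T} \<subseteq> {u_min..u_max}"
      and conta: "continuous_on {0..T} a"
      and vl_range: "\<forall>t\<in>{0..T}. 0 \<le> vl0 + integral {0..t} a \<and> vl0 + integral {0..t} a \<le> v_max"
      and init: "(xl0, x0, vl0, v0) \<in> state_space v_max"
    define vl where "vl t = vl0 + integral {0..t} a" for t
    define xl where "xl t = xl0 + integral {0..t} vl" for t
    have primitive: "((\<lambda>t. c + integral {0..t} g) has_real_derivative g t) (at t within {0..T})"
      if "continuous_on {0..T} g" "t \<in> {0..T}" for c t and g :: "real \<Rightarrow> real"
      using has_vector_derivative_add[OF has_vector_derivative_const
          integral_has_vector_derivative[OF that], of c]
      by (simp add: has_real_derivative_iff_has_vector_derivative)
    have dvl: "(vl has_real_derivative a t) (at t within {0..T})" if "t \<in> {0..T}" for t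
      unfolding vl_def[abs_def] by (rule primitive[OF conta that])
    then have contvl: "continuous_on {0..T} vl" by (rule DERIV_continuous_on)
    have dxl: "(xl has_real_derivative vl t) (at t within {0..T})" if "t \<in> {0..T}" for t
      unfolding xl_def[abs_def] by (rule primitive[OF contvl that])
    have leader0: "xl 0 = xl0" "vl 0 = vl0" by (simp_all add: xl_def vl_def)
    have vl: "vl t \<in> {0..v_max}" if "t \<in> {0..T}" for t
      using vl_range that by (simp add: vl_def)
    have u': "u t \<in> {0..v_max}" if "t \<in> {0..T}" for t
      using u that assms by force
    have v0: "v0 \<in> {0..v_max}" and "x0 < xl0"
      using init by (auto simp: state_space_def)
    then have gap0: "x0 < xl 0" by (simp add: leader0)
    obtain x v where xv: "x 0 = x0" "v 0 = v0"
      and dx: "\<And>t. t \<in> {0..T} \<Longrightarrow> (x has_real_derivative v t) (at t within {0..T})"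
      and dv: "\<And>t. t \<in> {0..T} \<Longrightarrow> (v has_real_derivative
          accel k_v k_d k \<tau>\<^sub>s (xl t) (x t) (vl t) (v t) (u t)) (at t within {0..T})"
      and v: "\<And>t. t \<in> {0..T} \<Longrightarrow> v t \<in> {0..v_max}"
      and gap: "\<And>t. t \<in> {0..T} \<Longrightarrow> k_v / (v0 + H * k_d + k_v / (xl 0 - x0)) \<le> xl t - x t"
      using follower_solution[OF assms(1-4) less_imp_le[OF \<open>T > 0\<close>] H(1,2) dxl contvl contu vl u' v0 gap0]
      by blast
    let ?B = "k_v / (v0 + H * k_d + k_v / (xl0 - x0))"
    have B: "?B > 0"
      using assms(1,2) \<open>H > 0\<close> v0 \<open>x0 < xl0\<close>
      by (intro divide_pos_pos add_nonneg_pos add_pos_pos add_nonneg_nonneg mult_nonneg_nonneg) auto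
    have "is_solution k_v k_d k \<tau>\<^sub>s v_max T u a (xl 0, x 0, vl 0, v 0) (\<lambda>t. (xl t, x t, vl t, v t))"
    proof (rule C1_curve_is_solution[OF _ dxl dvl dx dv conta contu])
      show "(xl t, x t, vl t, v t) \<in> state_space v_max" if "t \<in> {0..T}" for t
        using vl[OF that] v[OF that] gap[OF that] B by (simp add: state_space_def leader0)
    qed (use \<open>T > 0\<close> in auto)
    moreover have "?B \<le> (INF t\<in>{0..T}. xl t - x t)"
      using gap \<open>T > 0\<close> by (intro cINF_greatest) (auto simp: leader0)
    ultimately show "\<exists>xl x vl v.
        is_solution k_v k_d k \<tau>\<^sub>s v_max T u a (xl0, x0, vl0, v0) (\<lambda>t. (xl t, x t, vl t, v t)) \<and>
        (INF t\<in>{0..T}. xl t - x t) \<ge> ?B \<and> ?B > 0"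
      using B unfolding leader0 xv by blast
  qed
qed

end
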